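(* The algebra $U(\mathfrak{sl}_2)_e$ has a presentation given by generators $E^2,F^2,\Lambda,H$ and relations $$[H,E^2]=4E^2,\qquad [H,F^2]=-4F^2,$$ $$16\,E^2F^2=(H^2-2H-2\Lambda)(H^2-6H-2\Lambda+8),$$ $$16\,F^2E^2=(H^2+2H-2\Lambda)(H^2+6H-2\Lambda+8),$$ $$\Lambda E^2=E^2\Lambda,\qquad \Lambda F^2=F^2\Lambda,\qquad \Lambda H=H\Lambda.$$ (That is, the algebra over $\mathbb C$ presented by four abstract generators denoted by the symbols $E^2,F^2,\Lambda,H$ subject to these relations is isomorphic to $U(\mathfrak{sl}_2)_e$ via the homomorphism sending the symbols to the elements $E^2,F^2,\Lambda,H$ of $U(\mathfrak{sl}_2)_e$ respectively.)
   Context: All algebras are unital associative algebras over $\mathbb C$, and $[x,y]=xy-yx$. $U(\mathfrak{sl}_2)$ is the algebra over $\mathbb C$ generated by $E,F,H$ subject to $[H,E]=2E$, $[H,F]=-2F$, $[E,F]=H$. Its Casimir element is $\Lambda=EF+FE+\frac{H^2}{2}$ (central). The algebra $U(\mathfrak{sl}_2)$ is $\mathbb Z$-graded by assigning degrees $1,-1,0$ to $E,F,H$ respectively; for $n\in\mathbb Z$ let $U_n$ denote the $n$-th homogeneous subspace, and define the subalgebra $U(\mathfrak{sl}_2)_e=\bigoplus_{n\in\mathbb Z}U_{2n}$. *)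

theory Defs
  imports Complex_Main "HOL-Library.Poly_Mapping"
begin

text \<open>Words over \<open>'g\<close> form the free monoid, written additively because \<^typ>\<open>'a \<Rightarrow>\<^sub>0 'b\<close>
  turns an additive monoid of exponents into its monoid algebra. The wrapper avoids
  declaring a global additive structure on lists.\<close>

datatype 'g word = Word (letters: "'g list")

instantiation word :: (type) monoid_add
begin

definition zero_word :: "'a word" where
  "0 = Word []"

definition plus_word :: "'a word \<Rightarrow> 'a word \<Rightarrow> 'a word" where
  "v + w = Word (letters v @ letters w)"

instance
  by standard (simp_all add: zero_word_def plus_word_def)

end

type_synonym 'g free_algebra = "'g word \<Rightarrow>\<^sub>0 complex"

definition free_gen :: "'g \<Rightarrow> 'g free_algebra" where
  "free_gen g = Poly_Mapping.single (Word [g]) 1"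

definition scalar :: "complex \<Rightarrow> 'g free_algebra" where
  "scalar c = Poly_Mapping.single 0 c"

definition lie_bracket :: "'a::ring \<Rightarrow> 'a \<Rightarrow> 'a" where
  "lie_bracket x y = x * y - y * x"

lemma scalar_0: "scalar 0 = 0"
  and scalar_1: "scalar 1 = 1"
  and scalar_add: "scalar (a + b) = scalar a + scalar b"
  and scalar_mult: "scalar (a * b) = scalar a * scalar b"
  by (simp_all add: scalar_def single_add mult_single)

lemma scalar_central: "scalar c * x = x * scalar c"
proof (induction x rule: Poly_Mapping.update_induct)
  case const
  then show ?case by simp
next
  case (update f w a)
  then have "Poly_Mapping.update w a f = f + Poly_Mapping.single w a"
    by (intro poly_mapping_eqI)
      (auto simp: lookup_update lookup_add lookup_single when_def in_keys_iff)
  moreover have "scalar c * Poly_Mapping.single w a = Poly_Mapping.single w a * scalar c"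
    by (simp add: scalar_def mult_single mult.commute)
  ultimately show ?case
    using update by (simp add: distrib_left distrib_right)
qed

text \<open>A two-sided ideal is closed under scalar multiplication, since scalars are elements of
  the free algebra.\<close>

inductive_set ideal_generated :: "'a::ring_1 set \<Rightarrow> 'a set" for R where
  zero: "0 \<in> ideal_generated R"
| gen: "r \<in> R \<Longrightarrow> a * r * b \<in> ideal_generated R"
| add: "x \<in> ideal_generated R \<Longrightarrow> y \<in> ideal_generated R \<Longrightarrow> x + y \<in> ideal_generated R"

lemma ideal_generated_mult_left: "x \<in> ideal_generated R \<Longrightarrow> c * x \<in> ideal_generated R"
proof (induction rule: ideal_generated.induct)
  case (gen r a b)
  then show ?case using ideal_generated.gen[of r R "c * a" b] by (simp add: mult.assoc)
qed (auto intro: ideal_generated.intros simp: distrib_left)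

lemma ideal_generated_mult_right: "x \<in> ideal_generated R \<Longrightarrow> x * c \<in> ideal_generated R"
proof (induction rule: ideal_generated.induct)
  case (gen r a b)
  then show ?case using ideal_generated.gen[of r R a "b * c"] by (simp add: mult.assoc)
qed (auto intro: ideal_generated.intros simp: distrib_right)

lemma ideal_generated_uminus: "x \<in> ideal_generated R \<Longrightarrow> - x \<in> ideal_generated R"
  using ideal_generated_mult_left[of x R "- 1"] by simp

text \<open>A presentation is encoded by a type of abstract generators together with its set of
  relators, where a relation \<open>l = r\<close> is represented by the relator \<open>l - r\<close>.\<close>

class presentation =
  fixes relators :: "'a free_algebra set"

definition cong_rel :: "'g::presentation free_algebra \<Rightarrow> 'g free_algebra \<Rightarrow> bool" where
  "cong_rel x y \<longleftrightarrow> x - y \<in> ideal_generated relators"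

lemma cong_rel_equivp: "equivp (cong_rel :: 'g::presentation free_algebra \<Rightarrow> _)"
proof (rule equivpI)
  show "reflp (cong_rel :: 'g free_algebra \<Rightarrow> _)"
    by (auto intro!: reflpI ideal_generated.zero simp: cong_rel_def)
  show "symp (cong_rel :: 'g free_algebra \<Rightarrow> _)"
  proof (rule sympI)
    fix x y :: "'g free_algebra"
    assume "cong_rel x y"
    then show "cong_rel y x"
      using ideal_generated_uminus[of "x - y"] by (simp add: cong_rel_def)
  qed
  show "transp (cong_rel :: 'g free_algebra \<Rightarrow> _)"
  proof (rule transpI)
    fix x y z :: "'g free_algebra"
    assume "cong_rel x y" "cong_rel y z"
    then show "cong_rel x z"
      using ideal_generated.add[of "x - y" _ "y - z"] by (simp add: cong_rel_def)
  qed
qed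

quotient_type (overloaded) 'g presented_algebra = "'g::presentation free_algebra" / cong_rel
  by (rule cong_rel_equivp)

instantiation presented_algebra :: (presentation) ring
begin

lift_definition zero_presented_algebra :: "'a presented_algebra" is 0 .

lift_definition plus_presented_algebra ::
    "'a presented_algebra \<Rightarrow> 'a presented_algebra \<Rightarrow> 'a presented_algebra" is "(+)"
proof -
  fix a b c d :: "'a free_algebra"
  assume "cong_rel a b" "cong_rel c d"
  then have "(a - b) + (c - d) \<in> ideal_generated relators"
    unfolding cong_rel_def by (rule ideal_generated.add)
  then show "cong_rel (a + c) (b + d)"
    unfolding cong_rel_def by (simp add: algebra_simps)
qed

lift_definition uminus_presented_algebra ::
    "'a presented_algebra \<Rightarrow> 'a presented_algebra" is uminus
proof -
  fix a b :: "'a free_algebra"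
  assume "cong_rel a b"
  then show "cong_rel (- a) (- b)"
    unfolding cong_rel_def using ideal_generated_uminus[of "a - b"] by simp
qed

lift_definition minus_presented_algebra ::
    "'a presented_algebra \<Rightarrow> 'a presented_algebra \<Rightarrow> 'a presented_algebra" is "(-)"
proof -
  fix a b c d :: "'a free_algebra"
  assume "cong_rel a b" "cong_rel c d"
  then have "(a - b) + - (c - d) \<in> ideal_generated relators"
    unfolding cong_rel_def by (intro ideal_generated.add ideal_generated_uminus)
  then show "cong_rel (a - c) (b - d)"
    unfolding cong_rel_def by (simp add: algebra_simps)
qed

lift_definition times_presented_algebra ::
    "'a presented_algebra \<Rightarrow> 'a presented_algebra \<Rightarrow> 'a presented_algebra" is "(*)"
proof -
  fix a b c d :: "'a free_algebra"
  assume "cong_rel a b" "cong_rel c d"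
  then have "(a - b) * c + b * (c - d) \<in> ideal_generated relators"
    unfolding cong_rel_def
    by (intro ideal_generated.add ideal_generated_mult_left ideal_generated_mult_right)
  then show "cong_rel (a * c) (b * d)"
    unfolding cong_rel_def by (simp add: algebra_simps)
qed

instance
  by standard (transfer; simp add: algebra_simps cong_rel_def ideal_generated.zero)+

end

text \<open>The zero algebra is a possible quotient, so \<open>presented_algebra\<close> is unital without being
  an instance of \<^class>\<open>ring_1\<close>, which demands \<open>0 \<noteq> 1\<close>.\<close>

instantiation presented_algebra :: (presentation) monoid_mult
begin

lift_definition one_presented_algebra :: "'a presented_algebra" is 1 .

instance
  by standard (transfer; simp add: algebra_simps cong_rel_def ideal_generated.zero)+

end

lift_definition scaleC :: "complex \<Rightarrow> 'g::presentation presented_algebra \<Rightarrow> 'g presented_algebra"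
    (infixr "*\<^sub>C" 75) is "\<lambda>c x. scalar c * x"
proof -
  fix c and a b :: "'g free_algebra"
  assume "cong_rel a b"
  then show "cong_rel (scalar c * a) (scalar c * b)"
    unfolding cong_rel_def right_diff_distrib[symmetric] by (rule ideal_generated_mult_left)
qed

lift_definition gen :: "'g::presentation \<Rightarrow> 'g presented_algebra" is free_gen .

interpretation presented_algebra: vector_space scaleC
  by standard
    (transfer; simp add: scalar_add scalar_mult scalar_1 algebra_simps cong_rel_def
      ideal_generated.zero)+

lemma scaleC_mult_left: "(c *\<^sub>C x) * y = c *\<^sub>C (x * y)"
  by transfer (simp add: mult.assoc cong_rel_def ideal_generated.zero)

lemma scaleC_mult_right: "x * (c *\<^sub>C y) = c *\<^sub>C (x * y)"
proof transfer
  fix x y :: "'a free_algebra" and c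
  have "x * (scalar c * y) = (scalar c * x) * y"
    by (simp add: mult.assoc[symmetric] scalar_central[of c x])
  then show "cong_rel (x * (scalar c * y)) (scalar c * (x * y))"
    by (simp add: mult.assoc cong_rel_def ideal_generated.zero)
qed

definition algebra_hom ::
    "('g::presentation presented_algebra \<Rightarrow> 'h::presentation presented_algebra) \<Rightarrow> bool" where
  "algebra_hom \<phi> \<longleftrightarrow> Vector_Spaces.linear scaleC scaleC \<phi> \<and> \<phi> 1 = 1
     \<and> (\<forall>x y. \<phi> (x * y) = \<phi> x * \<phi> y)"

datatype sl2_gen = E_sym | F_sym | H_sym

instantiation sl2_gen :: presentation
begin

definition relators_sl2_gen :: "sl2_gen free_algebra set" where
  "relators_sl2_gen =
    (let e = free_gen E_sym; f = free_gen F_sym; h = free_gen H_sym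
     in {lie_bracket h e - 2 * e,
         lie_bracket h f - (- 2 * f),
         lie_bracket e f - h})"

instance ..

end

type_synonym U_sl2 = "sl2_gen presented_algebra"

abbreviation "sl2_E \<equiv> gen E_sym"
abbreviation "sl2_F \<equiv> gen F_sym"
abbreviation "sl2_H \<equiv> gen H_sym"

definition Casimir :: U_sl2 where
  "Casimir = sl2_E * sl2_F + sl2_F * sl2_E + (1/2) *\<^sub>C sl2_H ^ 2"

fun sl2_degree :: "sl2_gen \<Rightarrow> int" where
  "sl2_degree E_sym = 1"
| "sl2_degree F_sym = - 1"
| "sl2_degree H_sym = 0"

definition word_degree :: "sl2_gen word \<Rightarrow> int" where
  "word_degree w = sum_list (map sl2_degree (letters w))"

text \<open>The relators are homogeneous, so the grading of the free algebra descends to the quotient: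
  \<open>U_hom n\<close> consists of the classes of linear combinations of words of degree \<open>n\<close>.\<close>

definition U_hom :: "int \<Rightarrow> U_sl2 set" where
  "U_hom n = abs_presented_algebra ` {p. \<forall>w \<in> Poly_Mapping.keys p. word_degree w = n}"

definition U_even :: "U_sl2 set" where
  "U_even = presented_algebra.span (\<Union>n. U_hom (2 * n))"

datatype even_gen = E2_sym | F2_sym | Lambda_sym | Heven_sym

instantiation even_gen :: presentation
begin

definition relators_even_gen :: "even_gen free_algebra set" where
  "relators_even_gen =
    (let e2 = free_gen E2_sym; f2 = free_gen F2_sym; l = free_gen Lambda_sym;
         h = free_gen Heven_sym
     in {lie_bracket h e2 - 4 * e2,
         lie_bracket h f2 - (- 4 * f2),
         16 * e2 * f2 - (h^2 - 2 * h - 2 * l) * (h^2 - 6 * h - 2 * l + 8),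
         16 * f2 * e2 - (h^2 + 2 * h - 2 * l) * (h^2 + 6 * h - 2 * l + 8),
         l * e2 - e2 * l,
         l * f2 - f2 * l,
         l * h - h * l})"

instance ..

end

end

theory Submission
  imports Defs "HOL-Library.Function_Algebras" "HOL-Computational_Algebra.Polynomial"
begin

text \<open>Sending \<open>E\<^sup>2, F\<^sup>2, \<Lambda>, H\<close> to the elements so denoted respects the relations because \<open>E F\<close> and \<open>F E\<close>
  are polynomials in \<open>\<Lambda>\<close> and \<open>H\<close>, and \<open>E\<close>, \<open>F\<close> move past such a polynomial at the cost of
  shifting \<open>H\<close> by \<open>2\<close>. So there is a homomorphism from the presented algebra to \<open>U(sl\<^sub>2)\<close>; write
  \<open>R\<close> for its range.

  The range is the even part. It lies in the even part since the images of the generators have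
  even degree. Conversely, reading a word from the right, one shows that it lies in \<open>R\<close> if its
  degree is even and that \<open>E w\<close> and \<open>F w\<close> lie in \<open>R\<close> if the degree of \<open>w\<close> is odd
  (\<open>word_in_range\<close>); this only uses that \<open>E\<^sup>2, F\<^sup>2, E F, F E, H\<close> are all in \<open>R\<close>.

  For injectivity, the relations rewrite every element of the presented algebra as a combination of
  the monomials \<open>(E\<^sup>2)\<^sup>n H\<^sup>i \<Lambda>\<^sup>j\<close> and \<open>(F\<^sup>2)\<^sup>n H\<^sup>i \<Lambda>\<^sup>j\<close> (\<open>normal_monomials_span\<close>). Their images are
  linearly independent: \<open>U(sl\<^sub>2)\<close> acts on a module of families with coordinates at
  vectors \<open>v\<^sub>n\<close>, \<open>n \<in> \<int>\<close>, over the polynomial ring in two variables \<open>h\<close> and \<open>\<lambda>\<close>, where \<open>H\<close> and \<open>\<Lambda>\<close> act on \<open>v\<^sub>0\<close> as \<open>h\<close> and \<open>\<lambda>\<close>,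
  and where \<open>E\<close> raises and \<open>F\<close> lowers the index without a coefficient when moving away from
  \<open>v\<^sub>0\<close>. The monomials take \<open>v\<^sub>0\<close> to \<open>h\<^sup>i \<lambda>\<^sup>j v\<^bsub>2n\<^esub>\<close> and \<open>h\<^sup>i \<lambda>\<^sup>j v\<^bsub>-2n\<^esub>\<close>
  (\<open>normal_monomial_weight\<close>), so reading off coefficients gives dual functionals.\<close>

section \<open>Actions of presented algebras\<close>

lemma free_algebra_eq_sum_monomials:
  fixes p :: "'g free_algebra"
  shows "p = (\<Sum>w\<in>Poly_Mapping.keys p. Poly_Mapping.single w (Poly_Mapping.lookup p w))"
proof (rule poly_mapping_eqI)
  fix u
  have "Poly_Mapping.lookup (\<Sum>w\<in>A. Poly_Mapping.single w (Poly_Mapping.lookup p w)) u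
      = (if u \<in> A then Poly_Mapping.lookup p u else 0)"
    if "finite A" for A
    using that
    by (induction A rule: finite_induct) (auto simp: lookup_add lookup_single when_def)
  then show "Poly_Mapping.lookup p u
      = Poly_Mapping.lookup (\<Sum>w\<in>Poly_Mapping.keys p. Poly_Mapping.single w (Poly_Mapping.lookup p w)) u"
    by (simp add: in_keys_iff)
qed

lemma free_algebra_induct [case_names zero add monomial]:
  fixes p :: "'g free_algebra"
  assumes "P 0" and add: "\<And>x y. P x \<Longrightarrow> P y \<Longrightarrow> P (x + y)"
    and "\<And>w. w \<in> Poly_Mapping.keys p \<Longrightarrow> P (Poly_Mapping.single w (Poly_Mapping.lookup p w))"
  shows "P p"
proof -
  have "P (\<Sum>w\<in>A. Poly_Mapping.single w (Poly_Mapping.lookup p w))" if "A \<subseteq> Poly_Mapping.keys p" for A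
    using finite_subset[OF that finite_keys] that
    by (induction A rule: finite_induct) (auto intro: assms)
  then show ?thesis
    by (subst free_algebra_eq_sum_monomials) simp
qed

text \<open>The universal property of the free algebra, for representations: operators \<open>T g\<close> chosen freely
  for the generators turn the vector space into a module. Working with modules rather than with
  homomorphisms covers both uses below: the homomorphism into \<open>U(sl\<^sub>2)\<close> (through left
  multiplication) and the weight module.\<close>

locale word_action = vector_space scale
  for scale :: "complex \<Rightarrow> 'v::ab_group_add \<Rightarrow> 'v" +
  fixes T :: "'g \<Rightarrow> 'v \<Rightarrow> 'v"
  assumes T_add: "T g (v + w) = T g v + T g w"
    and T_scale: "T g (scale c v) = scale c (T g v)"
begin

definition act :: "'g free_algebra \<Rightarrow> 'v \<Rightarrow> 'v" where
  "act p v = (\<Sum>w\<in>Poly_Mapping.keys p. scale (Poly_Mapping.lookup p w) (foldr T (letters w) v))"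

lemma foldr_T_add: "foldr T gs (v + w) = foldr T gs v + foldr T gs w"
  by (induction gs) (simp_all add: T_add)

lemma foldr_T_scale: "foldr T gs (scale c v) = scale c (foldr T gs v)"
  by (induction gs) (simp_all add: T_scale)

lemma act_superset:
  assumes "finite S" "Poly_Mapping.keys p \<subseteq> S"
  shows "act p v = (\<Sum>w\<in>S. scale (Poly_Mapping.lookup p w) (foldr T (letters w) v))"
  unfolding act_def using assms
  by (intro sum.mono_neutral_left) (auto simp: in_keys_iff)

lemma act_zero_left: "act 0 v = 0"
  by (simp add: act_def)

lemma act_add_left: "act (p + q) v = act p v + act q v"
proof -
  let ?S = "Poly_Mapping.keys p \<union> Poly_Mapping.keys q"
  have "act r v = (\<Sum>w\<in>?S. scale (Poly_Mapping.lookup r w) (foldr T (letters w) v))"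
    if "r \<in> {p, q, p + q}" for r
    using that keys_add[of p q] by (intro act_superset) auto
  then show ?thesis
    by (simp add: lookup_add scale_left_distrib sum.distrib)
qed

lemma act_single: "act (Poly_Mapping.single w c) v = scale c (foldr T (letters w) v)"
  by (cases "c = 0") (simp_all add: act_def)

lemma act_add_right: "act p (v + w) = act p v + act p w"
  by (simp add: act_def foldr_T_add scale_right_distrib sum.distrib)

lemma act_scale_right: "act p (scale c v) = scale c (act p v)"
  by (simp add: act_def foldr_T_scale scale_sum_right mult.commute)

lemma act_zero_right: "act p 0 = 0"
  using act_scale_right[of p 0 0] by simp

lemma act_diff_left: "act (p - q) v = act p v - act q v"
  using act_add_left[of "p - q" q v] by simp

lemma act_uminus_left: "act (- p) v = - act p v"
  using act_diff_left[of 0 p v] by (simp add: act_zero_left)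

lemma act_mult: "act (p * q) v = act p (act q v)"
proof (induction p rule: free_algebra_induct)
  case zero
  then show ?case by (simp add: act_zero_left)
next
  case (add x y)
  then show ?case by (simp add: distrib_right act_add_left)
next
  case (monomial u)
  show ?case
  proof (induction q rule: free_algebra_induct)
    case zero
    then show ?case by (simp add: act_zero_left act_zero_right)
  next
    case (add x y)
    then show ?case by (simp add: distrib_left act_add_left act_add_right)
  next
    case (monomial w)
    then show ?case
      by (simp add: mult_single act_single foldr_T_scale plus_word_def)
  qed
qed

lemma act_scalar: "act (scalar c) v = scale c v"
  by (simp add: scalar_def act_single zero_word_def)

lemma act_one: "act 1 v = v"
  using act_scalar[of 1 v] by (simp add: scalar_1)

lemma act_numeral: "act (numeral k) v = scale (numeral k) v"
  using act_scalar[of "numeral k" v] by (simp add: scalar_def)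

lemma act_free_gen: "act (free_gen g) v = T g v"
  by (simp add: free_gen_def act_single)

lemmas act_simps = act_add_left act_diff_left act_uminus_left act_mult act_one act_numeral
  act_free_gen power2_eq_square

end

text \<open>An action that kills the relators kills the ideal that they generate, hence descends to the
  quotient.\<close>

locale presented_action = word_action scale T
  for scale :: "complex \<Rightarrow> 'v::ab_group_add \<Rightarrow> 'v" and T :: "'g::presentation \<Rightarrow> 'v \<Rightarrow> 'v" +
  assumes relators_act: "r \<in> relators \<Longrightarrow> act r v = 0"
begin

lemma ideal_act: "x \<in> ideal_generated relators \<Longrightarrow> act x v = 0"
  by (induction arbitrary: v rule: ideal_generated.induct)
    (simp_all add: act_zero_left act_add_left act_mult relators_act act_zero_right)

definition smul :: "'g presented_algebra \<Rightarrow> 'v \<Rightarrow> 'v" where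
  "smul x = act (rep_presented_algebra x)"

lemma smul_abs: "smul (abs_presented_algebra p) v = act p v"
proof -
  have "cong_rel (rep_presented_algebra (abs_presented_algebra p)) p"
    by (rule Quotient3_rep_abs[OF Quotient3_presented_algebra])
      (simp add: cong_rel_def ideal_generated.zero)
  then show ?thesis
    unfolding smul_def cong_rel_def using ideal_act act_diff_left by fastforce
qed

lemma smul_add: "smul (x + y) v = smul x v + smul y v"
  by (induction x rule: presented_algebra.abs_induct; induction y rule: presented_algebra.abs_induct)
    (simp add: plus_presented_algebra.abs_eq smul_abs act_add_left)

lemma smul_mult: "smul (x * y) v = smul x (smul y v)"
  by (induction x rule: presented_algebra.abs_induct; induction y rule: presented_algebra.abs_induct)
    (simp add: times_presented_algebra.abs_eq smul_abs act_mult)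

lemma smul_one: "smul 1 v = v"
  by (simp add: one_presented_algebra_def smul_abs act_one)

lemma smul_scaleC: "smul (c *\<^sub>C x) v = scale c (smul x v)"
  by (induction x rule: presented_algebra.abs_induct)
    (simp add: scaleC.abs_eq smul_abs act_mult act_scalar)

lemma smul_gen: "smul (gen g) v = T g v"
  by (simp add: gen_def smul_abs act_free_gen)

lemma smul_zero: "smul 0 v = 0"
  using smul_scaleC[of 0 0 v] by simp

end

lemma abs_add: "abs_presented_algebra (p + q) = abs_presented_algebra p + abs_presented_algebra q"
  by (simp add: plus_presented_algebra.abs_eq)

lemma abs_monomial_induct:
  fixes p :: "'g::presentation free_algebra"
  assumes "presented_algebra.subspace W"
    and "\<And>w. w \<in> Poly_Mapping.keys p \<Longrightarrow> abs_presented_algebra (Poly_Mapping.single w 1) \<in> W"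
  shows "abs_presented_algebra p \<in> W"
proof (induction p rule: free_algebra_induct)
  case zero
  then show ?case
    using presented_algebra.subspace_0[OF assms(1)] by (simp add: zero_presented_algebra_def)
next
  case (add x y)
  then show ?case
    using presented_algebra.subspace_add[OF assms(1)] by (simp add: abs_add)
next
  case (monomial w)
  have "Poly_Mapping.single w (Poly_Mapping.lookup p w)
      = scalar (Poly_Mapping.lookup p w) * Poly_Mapping.single w 1"
    by (simp add: scalar_def mult_single)
  then show ?case
    using presented_algebra.subspace_scale[OF assms(1) assms(2)[OF monomial]]
    by (simp add: scaleC.abs_eq)
qed

lemma abs_word_Cons:
  "abs_presented_algebra (Poly_Mapping.single (Word (g # gs)) 1)
    = gen g * abs_presented_algebra (Poly_Mapping.single (Word gs) 1)"
  by (simp add: gen_def free_gen_def times_presented_algebra.abs_eq mult_single plus_word_def)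

lemma abs_word_Nil: "abs_presented_algebra (Poly_Mapping.single (Word []) 1) = 1"
  by (simp add: one_presented_algebra_def zero_word_def[symmetric])

text \<open>A subspace stable under left multiplication by generators is a left ideal, and a left ideal
  that contains the unit is everything. This is the induction principle for elements of a presented
  algebra.\<close>

lemma presented_algebra_subspace_UNIV:
  fixes W :: "'g::presentation presented_algebra set"
  assumes "presented_algebra.subspace W" "1 \<in> W" and left: "\<And>g x. x \<in> W \<Longrightarrow> gen g * x \<in> W"
  shows "x \<in> W"
proof -
  have "abs_presented_algebra (Poly_Mapping.single (Word gs) 1) \<in> W" for gs
    by (induction gs) (simp_all add: assms abs_word_Nil abs_word_Cons)
  then have "abs_presented_algebra (Poly_Mapping.single w 1) \<in> W" for w
    by (cases w) simp
  then show ?thesis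
    by (induction x rule: presented_algebra.abs_induct)
      (auto intro: abs_monomial_induct assms)
qed


lemma abs_diff: "abs_presented_algebra (p - q) = abs_presented_algebra p - abs_presented_algebra q"
  by (simp add: minus_presented_algebra.abs_eq)

lemma abs_uminus: "abs_presented_algebra (- p) = - abs_presented_algebra p"
  by (simp add: uminus_presented_algebra.abs_eq)

lemma abs_mult: "abs_presented_algebra (p * q) = abs_presented_algebra p * abs_presented_algebra q"
  by (simp add: times_presented_algebra.abs_eq)

lemma abs_one: "abs_presented_algebra 1 = 1"
  by (simp add: one_presented_algebra_def)

lemma abs_free_gen: "abs_presented_algebra (free_gen g) = gen g"
  by (simp add: gen_def)

lemma abs_numeral: "abs_presented_algebra (numeral k) = numeral k *\<^sub>C 1"
proof -
  have "numeral k = scalar (numeral k) * (1 :: 'a free_algebra)"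
    by (simp add: scalar_def)
  then show ?thesis
    by (metis abs_one scaleC.abs_eq)
qed

lemmas abs_simps = abs_add abs_diff abs_uminus abs_mult abs_one abs_free_gen abs_numeral
  scaleC_mult_left scaleC_mult_right power2_eq_square

lemma abs_relator: "r \<in> relators \<Longrightarrow> abs_presented_algebra r = 0"
  using ideal_generated.gen[of r relators 1 1]
  by (simp add: zero_presented_algebra_def presented_algebra.abs_eq_iff cong_rel_def)

text \<open>Closure of a span under left multiplication may be tested on the spanning set.\<close>

lemma left_mult_span:
  assumes "\<And>b. b \<in> S \<Longrightarrow> a * b \<in> presented_algebra.span S"
    and "x \<in> presented_algebra.span S"
  shows "a * x \<in> presented_algebra.span S"
  using assms(2)
proof (induction rule: presented_algebra.span_induct_alt)
  case base
  then show ?case by (simp add: presented_algebra.span_zero)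
next
  case (step c b y)
  then show ?case
    by (simp add: distrib_left scaleC_mult_right assms(1)
        presented_algebra.span_add presented_algebra.span_scale)
qed

section \<open>Identities in the enveloping algebra\<close>

lemma sl2_E_H: "sl2_E * sl2_H = sl2_H * sl2_E - sl2_E - sl2_E"
  and sl2_F_H: "sl2_F * sl2_H = sl2_H * sl2_F + sl2_F + sl2_F"
  and sl2_F_E: "sl2_F * sl2_E = sl2_E * sl2_F - sl2_H"
proof -
  have two: "2 *\<^sub>C x = x + x" for x :: U_sl2
    using presented_algebra.scale_left_distrib[of 1 1 x] by simp
  have "abs_presented_algebra
      (lie_bracket (free_gen H_sym) (free_gen E_sym) - 2 * free_gen E_sym) = (0 :: U_sl2)"
    by (rule abs_relator) (simp add: relators_sl2_gen_def Let_def)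
  then show "sl2_E * sl2_H = sl2_H * sl2_E - sl2_E - sl2_E"
    by (simp add: lie_bracket_def abs_simps two algebra_simps)
  have "abs_presented_algebra
      (lie_bracket (free_gen H_sym) (free_gen F_sym) - (- 2 * free_gen F_sym)) = (0 :: U_sl2)"
    by (rule abs_relator) (simp add: relators_sl2_gen_def Let_def)
  then show "sl2_F * sl2_H = sl2_H * sl2_F + sl2_F + sl2_F"
    by (simp add: lie_bracket_def abs_simps two algebra_simps)
  have "abs_presented_algebra
      (lie_bracket (free_gen E_sym) (free_gen F_sym) - free_gen H_sym) = (0 :: U_sl2)"
    by (rule abs_relator) (simp add: relators_sl2_gen_def Let_def)
  then show "sl2_F * sl2_E = sl2_E * sl2_F - sl2_H"
    by (simp add: lie_bracket_def abs_simps algebra_simps)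
qed

text \<open>A presented algebra may be trivial, so its elements include no numerals, and integers
  act only as scalars. Expanding these into repeated sums lets the group simplifier collect and cancel like terms.\<close>

lemma scaleC_numeral:
  "numeral (Num.Bit0 k) *\<^sub>C x = numeral k *\<^sub>C x + numeral k *\<^sub>C x"
  "numeral (Num.Bit1 k) *\<^sub>C x = numeral k *\<^sub>C x + numeral k *\<^sub>C x + x"
  "numeral Num.One *\<^sub>C x = x"
  by (simp_all only: numeral_Bit0 numeral_Bit1 numeral_One presented_algebra.scale_left_distrib
      presented_algebra.scale_one)

lemma four_EF: "4 *\<^sub>C (sl2_E * sl2_F) = 2 *\<^sub>C Casimir + 2 *\<^sub>C sl2_H - sl2_H * sl2_H"
  and four_FE: "4 *\<^sub>C (sl2_F * sl2_E) = 2 *\<^sub>C Casimir - 2 *\<^sub>C sl2_H - sl2_H * sl2_H"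
proof -
  have "2 *\<^sub>C Casimir = 2 *\<^sub>C (sl2_E * sl2_F) + 2 *\<^sub>C (sl2_F * sl2_E) + sl2_H * sl2_H"
    by (simp add: Casimir_def power2_eq_square presented_algebra.scale_right_distrib)
  then show "4 *\<^sub>C (sl2_E * sl2_F) = 2 *\<^sub>C Casimir + 2 *\<^sub>C sl2_H - sl2_H * sl2_H"
    and "4 *\<^sub>C (sl2_F * sl2_E) = 2 *\<^sub>C Casimir - 2 *\<^sub>C sl2_H - sl2_H * sl2_H"
    by (simp_all add: scaleC_numeral sl2_F_E algebra_simps)
qed

lemma two_scaleC_cancel:
  assumes "x + x = y + y" shows "x = (y :: 'g::presentation presented_algebra)"
proof -
  have "(1/2) *\<^sub>C (2 *\<^sub>C x) = (1/2) *\<^sub>C (2 *\<^sub>C y)"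
    using assms by (simp only: scaleC_numeral)
  then show ?thesis by simp
qed

text \<open>Doubling clears the denominator of the Casimir element, so commutation with it can be checked on
  integral combinations of words, all moved to the order \<open>H, E, F\<close>.\<close>

lemma two_Casimir: "Casimir + Casimir
    = sl2_E * sl2_F + sl2_E * sl2_F + sl2_E * sl2_F + sl2_E * sl2_F - sl2_H - sl2_H + sl2_H * sl2_H"
proof -
  have "Casimir + Casimir = 4 *\<^sub>C (sl2_E * sl2_F) - sl2_H - sl2_H + sl2_H * sl2_H"
    unfolding four_EF by (simp add: scaleC_numeral)
  then show ?thesis by (simp add: scaleC_numeral add.assoc)
qed

lemma sl2_word_simps:
  "sl2_E * (sl2_H * x) = sl2_H * (sl2_E * x) - sl2_E * x - sl2_E * x"
  "sl2_F * (sl2_H * x) = sl2_H * (sl2_F * x) + sl2_F * x + sl2_F * x"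
  "sl2_F * (sl2_E * x) = sl2_E * (sl2_F * x) - sl2_H * x"
  by (simp_all only: mult.assoc[symmetric] sl2_E_H sl2_F_H sl2_F_E left_diff_distrib distrib_right)

lemma Casimir_commute_if_double:
  assumes "(Casimir + Casimir) * x = x * (Casimir + Casimir)"
  shows "Casimir * x = x * Casimir"
  by (rule two_scaleC_cancel) (use assms in \<open>simp only: distrib_left distrib_right\<close>)

lemma Casimir_E: "Casimir * sl2_E = sl2_E * Casimir"
  by (rule Casimir_commute_if_double)
    (simp add: two_Casimir algebra_simps sl2_E_H sl2_F_H sl2_F_E sl2_word_simps)

lemma Casimir_F: "Casimir * sl2_F = sl2_F * Casimir"
  by (rule Casimir_commute_if_double)
    (simp add: two_Casimir algebra_simps sl2_E_H sl2_F_H sl2_F_E sl2_word_simps)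

lemma Casimir_H: "Casimir * sl2_H = sl2_H * Casimir"
  by (rule Casimir_commute_if_double)
    (simp add: two_Casimir algebra_simps sl2_E_H sl2_F_H sl2_F_E sl2_word_simps)

text \<open>If \<open>x y\<close> is a polynomial in commuting weights and moving \<open>x\<close> past that polynomial shifts it
  from \<open>P\<close> to \<open>Q\<close>, then \<open>x x y y = x (x y) y\<close> is, up to scalars, the product of both.\<close>

lemma square_mult_square_if_shift:
  fixes x y :: "'g::presentation presented_algebra"
  assumes P: "4 *\<^sub>C (x * y) = - P" and shift: "x * P = Q * x" and comm: "Q * P = P * Q"
  shows "16 *\<^sub>C (x ^ 2 * y ^ 2) = P * Q"
proof -
  have "16 *\<^sub>C (x ^ 2 * y ^ 2) = 4 *\<^sub>C (x * (4 *\<^sub>C (x * y)) * y)"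
    by (simp add: power2_eq_square mult.assoc scaleC_mult_left scaleC_mult_right)
  also have "\<dots> = - (4 *\<^sub>C ((x * P) * y))"
    by (simp add: P)
  also have "\<dots> = - (Q * (4 *\<^sub>C (x * y)))"
    unfolding shift by (simp add: mult.assoc scaleC_mult_right)
  also have "\<dots> = P * Q"
    by (simp add: P comm)
  finally show ?thesis .
qed

lemma E2_F2: "16 *\<^sub>C (sl2_E ^ 2 * sl2_F ^ 2)
    = (sl2_H ^ 2 - 2 *\<^sub>C sl2_H - 2 *\<^sub>C Casimir)
      * (sl2_H ^ 2 - 6 *\<^sub>C sl2_H - 2 *\<^sub>C Casimir + 8 *\<^sub>C 1)"
proof (rule square_mult_square_if_shift)
  show "4 *\<^sub>C (sl2_E * sl2_F) = - (sl2_H ^ 2 - 2 *\<^sub>C sl2_H - 2 *\<^sub>C Casimir)"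
    by (simp add: four_EF power2_eq_square)
qed (simp_all add: scaleC_numeral power2_eq_square algebra_simps
    Casimir_E Casimir_H sl2_E_H sl2_word_simps)

lemma F2_E2: "16 *\<^sub>C (sl2_F ^ 2 * sl2_E ^ 2)
    = (sl2_H ^ 2 + 2 *\<^sub>C sl2_H - 2 *\<^sub>C Casimir)
      * (sl2_H ^ 2 + 6 *\<^sub>C sl2_H - 2 *\<^sub>C Casimir + 8 *\<^sub>C 1)"
proof (rule square_mult_square_if_shift)
  show "4 *\<^sub>C (sl2_F * sl2_E) = - (sl2_H ^ 2 + 2 *\<^sub>C sl2_H - 2 *\<^sub>C Casimir)"
    by (simp add: four_FE power2_eq_square)
qed (simp_all add: scaleC_numeral power2_eq_square algebra_simps
    Casimir_F Casimir_H sl2_F_H sl2_word_simps)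

section \<open>The homomorphism\<close>

fun even_image :: "even_gen \<Rightarrow> U_sl2" where
  "even_image E2_sym = sl2_E ^ 2"
| "even_image F2_sym = sl2_F ^ 2"
| "even_image Lambda_sym = Casimir"
| "even_image Heven_sym = sl2_H"

interpretation even: word_action scaleC "\<lambda>g u. even_image g * u"
  by standard (simp_all add: distrib_left scaleC_mult_right)

lemma H_E2: "sl2_H * sl2_E ^ 2 - sl2_E ^ 2 * sl2_H = 4 *\<^sub>C sl2_E ^ 2"
  by (simp add: scaleC_numeral power2_eq_square algebra_simps sl2_E_H sl2_word_simps)

lemma H_F2: "sl2_H * sl2_F ^ 2 - sl2_F ^ 2 * sl2_H = - (4 *\<^sub>C sl2_F ^ 2)"
  by (simp add: scaleC_numeral power2_eq_square algebra_simps sl2_F_H sl2_word_simps)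

lemma Casimir_E2: "Casimir * sl2_E ^ 2 = sl2_E ^ 2 * Casimir"
  by (rule power_commuting_commutes[OF Casimir_E[symmetric], symmetric])

lemma Casimir_F2: "Casimir * sl2_F ^ 2 = sl2_F ^ 2 * Casimir"
  by (rule power_commuting_commutes[OF Casimir_F[symmetric], symmetric])

interpretation even: presented_action scaleC "\<lambda>g u. even_image g * u"
proof
  fix r :: "even_gen free_algebra" and v :: U_sl2
  assume "r \<in> relators"
  then consider
      "r = lie_bracket (free_gen Heven_sym) (free_gen E2_sym) - 4 * free_gen E2_sym"
    | "r = lie_bracket (free_gen Heven_sym) (free_gen F2_sym) - (- 4 * free_gen F2_sym)"
    | "r = 16 * free_gen E2_sym * free_gen F2_sym
        - ((free_gen Heven_sym)^2 - 2 * free_gen Heven_sym - 2 * free_gen Lambda_sym)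
          * ((free_gen Heven_sym)^2 - 6 * free_gen Heven_sym - 2 * free_gen Lambda_sym + 8)"
    | "r = 16 * free_gen F2_sym * free_gen E2_sym
        - ((free_gen Heven_sym)^2 + 2 * free_gen Heven_sym - 2 * free_gen Lambda_sym)
          * ((free_gen Heven_sym)^2 + 6 * free_gen Heven_sym - 2 * free_gen Lambda_sym + 8)"
    | "r = free_gen Lambda_sym * free_gen E2_sym - free_gen E2_sym * free_gen Lambda_sym"
    | "r = free_gen Lambda_sym * free_gen F2_sym - free_gen F2_sym * free_gen Lambda_sym"
    | "r = free_gen Lambda_sym * free_gen Heven_sym - free_gen Heven_sym * free_gen Lambda_sym"
    unfolding relators_even_gen_def Let_def by blast
  then show "even.act r v = 0"
  proof cases
    case 1
    then show ?thesis using arg_cong[OF H_E2, of "\<lambda>y. y * v"]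
      by (simp add: even.act_simps lie_bracket_def left_diff_distrib scaleC_mult_left mult.assoc)
  next
    case 2
    then show ?thesis using arg_cong[OF H_F2, of "\<lambda>y. y * v"]
      by (simp add: even.act_simps lie_bracket_def left_diff_distrib scaleC_mult_left mult.assoc)
  next
    case 3
    then show ?thesis using arg_cong[OF E2_F2, of "\<lambda>y. y * v"]
      by (simp add: even.act_simps distrib_right left_diff_distrib scaleC_mult_left mult.assoc)
  next
    case 4
    then show ?thesis using arg_cong[OF F2_E2, of "\<lambda>y. y * v"]
      by (simp add: even.act_simps distrib_right left_diff_distrib scaleC_mult_left mult.assoc)
  next
    case 5
    then show ?thesis using arg_cong[OF Casimir_E2, of "\<lambda>y. y * v"]
      by (simp add: even.act_simps mult.assoc)
  next
    case 6
    then show ?thesis using arg_cong[OF Casimir_F2, of "\<lambda>y. y * v"]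
      by (simp add: even.act_simps mult.assoc)
  next
    case 7
    then show ?thesis using arg_cong[OF Casimir_H, of "\<lambda>y. y * v"]
      by (simp add: even.act_simps mult.assoc)
  qed
qed

text \<open>The orbit map of the unit. It is multiplicative because the action is by left
  multiplications, which commute with right multiplications.\<close>

definition even_hom :: "even_gen presented_algebra \<Rightarrow> U_sl2" where
  "even_hom x = even.smul x 1"

lemma even_smul_mult_right: "even.smul x (u * w) = even.smul x u * w"
proof -
  have "x \<in> {x. \<forall>u w. even.smul x (u * w) = even.smul x u * w}"
    by (rule presented_algebra_subspace_UNIV)
      (auto simp: presented_algebra.subspace_def even.smul_zero even.smul_add even.smul_scaleC
        even.smul_one even.smul_mult even.smul_gen distrib_right scaleC_mult_left mult.assoc)
  then show ?thesis by simp
qed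

lemma even_smul: "even.smul x u = even_hom x * u"
  using even_smul_mult_right[of x 1 u] by (simp add: even_hom_def)

lemma even_hom_gen: "even_hom (gen g) = even_image g"
  by (simp add: even_hom_def even.smul_gen)

lemma even_hom_add: "even_hom (x + y) = even_hom x + even_hom y"
  by (simp add: even_hom_def even.smul_add)

lemma even_hom_scaleC: "even_hom (c *\<^sub>C x) = c *\<^sub>C even_hom x"
  by (simp add: even_hom_def even.smul_scaleC)

lemma even_hom_one: "even_hom 1 = 1"
  by (simp add: even_hom_def even.smul_one)

lemma even_hom_mult: "even_hom (x * y) = even_hom x * even_hom y"
proof -
  have "even_hom (x * y) = even.smul x (even_hom y)"
    by (simp add: even_hom_def even.smul_mult)
  then show ?thesis
    by (simp add: even_smul)
qed

lemma even_hom_power: "even_hom (x ^ n) = even_hom x ^ n"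
  by (induction n) (simp_all add: even_hom_one even_hom_mult)

lemma algebra_hom_even_hom: "algebra_hom even_hom"
  unfolding algebra_hom_def Vector_Spaces.linear_iff
  by (auto simp: even_hom_add even_hom_scaleC even_hom_one even_hom_mult
      presented_algebra.vector_space_axioms)


lemma even_hom_zero: "even_hom 0 = 0"
  by (simp add: even_hom_def even.smul_zero)

section \<open>Surjectivity\<close>

lemma word_degree_zero: "word_degree 0 = 0"
  by (simp add: word_degree_def zero_word_def)

lemma word_degree_add: "word_degree (v + w) = word_degree v + word_degree w"
  by (simp add: word_degree_def plus_word_def)

lemma U_hom_mult:
  assumes "x \<in> U_hom m" "y \<in> U_hom n"
  shows "x * y \<in> U_hom (m + n)"
proof -
  obtain p q where p: "x = abs_presented_algebra p" "\<forall>w\<in>Poly_Mapping.keys p. word_degree w = m"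
    and q: "y = abs_presented_algebra q" "\<forall>w\<in>Poly_Mapping.keys q. word_degree w = n"
    using assms by (auto simp: U_hom_def)
  have "\<forall>w\<in>Poly_Mapping.keys (p * q). word_degree w = m + n"
    using keys_mult[of p q] p(2) q(2) by (fastforce simp: word_degree_add)
  moreover have "x * y = abs_presented_algebra (p * q)"
    by (simp add: p q abs_mult)
  ultimately show ?thesis
    by (auto simp: U_hom_def)
qed

lemma U_hom_add:
  assumes "x \<in> U_hom n" "y \<in> U_hom n"
  shows "x + y \<in> U_hom n"
proof -
  obtain p q where p: "x = abs_presented_algebra p" "\<forall>w\<in>Poly_Mapping.keys p. word_degree w = n"
    and q: "y = abs_presented_algebra q" "\<forall>w\<in>Poly_Mapping.keys q. word_degree w = n"
    using assms by (auto simp: U_hom_def)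
  have "\<forall>w\<in>Poly_Mapping.keys (p + q). word_degree w = n"
    using keys_add[of p q] p(2) q(2) by blast
  moreover have "x + y = abs_presented_algebra (p + q)"
    by (simp add: p q abs_add)
  ultimately show ?thesis
    by (auto simp: U_hom_def)
qed

lemma U_hom_scalar: "c *\<^sub>C 1 \<in> U_hom 0"
proof -
  have "c *\<^sub>C 1 = abs_presented_algebra (scalar c)"
    by (simp add: scaleC.abs_eq flip: abs_one)
  moreover have "\<forall>w\<in>Poly_Mapping.keys (scalar c). word_degree w = 0"
    by (simp add: scalar_def word_degree_zero)
  ultimately show ?thesis
    unfolding U_hom_def by blast
qed

lemma U_hom_one: "1 \<in> U_hom 0"
  using U_hom_scalar[of 1] by simp

lemma U_hom_scaleC: "x \<in> U_hom n \<Longrightarrow> c *\<^sub>C x \<in> U_hom n"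
  using U_hom_mult[OF U_hom_scalar, of x n c] by (simp add: scaleC_mult_left)

lemma U_hom_gen: "gen g \<in> U_hom (sl2_degree g)"
proof -
  have "\<forall>w\<in>Poly_Mapping.keys (free_gen g). word_degree w = sl2_degree g"
    by (simp add: free_gen_def word_degree_def)
  then show ?thesis
    unfolding U_hom_def abs_free_gen[symmetric] by blast
qed

lemma even_image_homogeneous: "\<exists>k. even_image g \<in> U_hom (2 * k)"
proof -
  note E = U_hom_gen[of E_sym, simplified] and F = U_hom_gen[of F_sym, simplified]
    and H = U_hom_gen[of H_sym, simplified]
  have "even_image E2_sym \<in> U_hom (2 * 1)"
    using U_hom_mult[OF E E] by (simp add: power2_eq_square)
  moreover have "even_image F2_sym \<in> U_hom (2 * (- 1))"
    using U_hom_mult[OF F F] by (simp add: power2_eq_square)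
  moreover have "even_image Lambda_sym \<in> U_hom (2 * 0)"
    using U_hom_mult[OF E F] U_hom_mult[OF F E] U_hom_mult[OF H H]
    by (simp add: Casimir_def power2_eq_square U_hom_add U_hom_scaleC)
  moreover have "even_image Heven_sym \<in> U_hom (2 * 0)"
    using H by simp
  ultimately show ?thesis
    by (cases g) blast+
qed

text \<open>The even part contains the unit and is stable under left multiplication by the homogeneous
  elements of even degree that are the images of the generators.\<close>

lemma even_hom_in_U_even: "even_hom x \<in> U_even"
proof -
  have gen: "even_image g * u \<in> U_even" if "u \<in> U_even" for g u
    unfolding U_even_def
  proof (rule left_mult_span)
    fix b assume "b \<in> (\<Union>n. U_hom (2 * n))"
    then obtain n where "b \<in> U_hom (2 * n)" by blast
    moreover obtain k where "even_image g \<in> U_hom (2 * k)"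
      using even_image_homogeneous by blast
    ultimately have "even_image g * b \<in> U_hom (2 * (k + n))"
      using U_hom_mult by (fastforce simp: distrib_left)
    then show "even_image g * b \<in> presented_algebra.span (\<Union>n. U_hom (2 * n))"
      by (blast intro: presented_algebra.span_base)
  next
    show "u \<in> presented_algebra.span (\<Union>n. U_hom (2 * n))"
      using that by (simp add: U_even_def)
  qed
  have "1 \<in> U_hom (2 * 0)"
    using U_hom_one by simp
  then have one: "1 \<in> U_even"
    unfolding U_even_def by (blast intro: presented_algebra.span_base)
  have "x \<in> {x. even_hom x \<in> U_even}"
  proof (rule presented_algebra_subspace_UNIV)
    show "presented_algebra.subspace {x. even_hom x \<in> U_even}"
      by (auto simp: presented_algebra.subspace_def U_even_def even_hom_zero even_hom_add
          even_hom_scaleC presented_algebra.span_zero presented_algebra.span_add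
          presented_algebra.span_scale)
  qed (auto simp: one gen even_hom_one even_hom_mult even_hom_gen)
  then show ?thesis by simp
qed

lemma subspace_range_even_hom: "presented_algebra.subspace (range even_hom)"
  unfolding presented_algebra.subspace_def
proof (intro conjI ballI allI)
  show "0 \<in> range even_hom"
    using rangeI[of even_hom 0] by (simp add: even_hom_zero)
  show "u + v \<in> range even_hom" if "u \<in> range even_hom" "v \<in> range even_hom" for u v
    using that by (auto simp: even_hom_add[symmetric])
  show "c *\<^sub>C u \<in> range even_hom" if "u \<in> range even_hom" for c u
    using that by (auto simp: even_hom_scaleC[symmetric])
qed

lemma range_even_hom_mult:
  "u \<in> range even_hom \<Longrightarrow> v \<in> range even_hom \<Longrightarrow> u * v \<in> range even_hom"
  by (auto simp: even_hom_mult[symmetric])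

lemma even_image_in_range: "even_image g \<in> range even_hom"
  using rangeI[of even_hom "gen g"] by (simp add: even_hom_gen)

lemma H_in_range: "sl2_H \<in> range even_hom"
  and E2_in_range: "sl2_E * sl2_E \<in> range even_hom"
  and F2_in_range: "sl2_F * sl2_F \<in> range even_hom"
  and Casimir_in_range: "Casimir \<in> range even_hom"
  using even_image_in_range[of Heven_sym] even_image_in_range[of E2_sym]
    even_image_in_range[of F2_sym] even_image_in_range[of Lambda_sym]
  by (simp_all add: power2_eq_square)

lemma EF_in_range: "sl2_E * sl2_F \<in> range even_hom"
  and FE_in_range: "sl2_F * sl2_E \<in> range even_hom"
proof -
  have quarter: "u \<in> range even_hom" if "4 *\<^sub>C u \<in> range even_hom" for u
    using presented_algebra.subspace_scale[OF subspace_range_even_hom that, of "1/4"] by simp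
  note closed = presented_algebra.subspace_add presented_algebra.subspace_diff
    presented_algebra.subspace_scale
  show "sl2_E * sl2_F \<in> range even_hom"
    by (rule quarter, unfold four_EF)
      (intro closed subspace_range_even_hom range_even_hom_mult H_in_range Casimir_in_range)
  show "sl2_F * sl2_E \<in> range even_hom"
    by (rule quarter, unfold four_FE)
      (intro closed subspace_range_even_hom range_even_hom_mult H_in_range Casimir_in_range)
qed

text \<open>The statement for words of odd degree is the induction hypothesis needed when a letter \<open>E\<close> or \<open>F\<close>
  is prepended to them. Prepending \<open>H\<close> to such a word uses \<open>E H = (H - 2) E\<close> and
  \<open>F H = (H + 2) F\<close>; prepending \<open>E\<close> or \<open>F\<close> to a word of even degree leads to one of
  \<open>E E, F E, E F, F F\<close>, all of which are in the range.\<close>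

lemma word_in_range:
  defines "R \<equiv> range even_hom"
    and "cls gs \<equiv> abs_presented_algebra (Poly_Mapping.single (Word gs) 1)"
  shows "if even (word_degree (Word gs)) then cls gs \<in> R
    else sl2_E * cls gs \<in> R \<and> sl2_F * cls gs \<in> R"
proof (induction gs)
  case Nil
  show ?case
    using rangeI[of even_hom 1]
    by (simp add: word_degree_def cls_def R_def abs_word_Nil even_hom_one)
next
  case (Cons g gs)
  let ?u = "cls gs"
  have cls: "cls (g # gs) = gen g * ?u" for g
    by (simp add: cls_def abs_word_Cons)
  have deg: "word_degree (Word (g # gs)) = sl2_degree g + word_degree (Word gs)" for g
    by (simp add: word_degree_def)
  note mult = range_even_hom_mult[folded R_def]
  note mems = H_in_range[folded R_def] E2_in_range[folded R_def] F2_in_range[folded R_def]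
    EF_in_range[folded R_def] FE_in_range[folded R_def]
  note closed = presented_algebra.subspace_add[OF subspace_range_even_hom[folded R_def]]
    presented_algebra.subspace_diff[OF subspace_range_even_hom[folded R_def]]
  show ?case
  proof (cases "even (word_degree (Word gs))")
    case True
    then have "?u \<in> R" using Cons.IH by simp
    then have "x * ?u \<in> R" if "x \<in> R" for x
      using that mult by blast
    note prod = mems[THEN this]
    show ?thesis
      using True prod by (cases g) (simp_all add: cls deg mult.assoc)
  next
    case False
    then have E: "sl2_E * ?u \<in> R" and F: "sl2_F * ?u \<in> R" using Cons.IH by simp_all
    have "sl2_H * (sl2_E * ?u) \<in> R" "sl2_H * (sl2_F * ?u) \<in> R"
      using E F mems(1) mult by blast+
    then show ?thesis
      using False E F closed by (cases g) (simp_all add: cls deg sl2_word_simps)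
  qed
qed

lemma range_even_hom: "range even_hom = U_even"
proof
  show "range even_hom \<subseteq> U_even"
    using even_hom_in_U_even by blast
  have "x \<in> range even_hom" if hom: "x \<in> U_hom (2 * n)" for x n
  proof -
    obtain p where p: "x = abs_presented_algebra p"
      and deg: "\<And>w. w \<in> Poly_Mapping.keys p \<Longrightarrow> word_degree w = 2 * n"
      using hom by (auto simp: U_hom_def)
    show ?thesis
      unfolding p
    proof (rule abs_monomial_induct[OF subspace_range_even_hom])
      fix w assume "w \<in> Poly_Mapping.keys p"
      then have "even (word_degree w)" using deg by simp
      then show "abs_presented_algebra (Poly_Mapping.single w 1) \<in> range even_hom"
        using word_in_range[of "letters w"] by simp
    qed
  qed
  then show "U_even \<subseteq> range even_hom"
    unfolding U_even_def
    by (intro presented_algebra.span_minimal subspace_range_even_hom) blast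
qed


section \<open>A spanning set of the presented algebra\<close>

abbreviation "ev_E \<equiv> gen E2_sym"
abbreviation "ev_F \<equiv> gen F2_sym"
abbreviation "ev_L \<equiv> gen Lambda_sym"
abbreviation "ev_H \<equiv> gen Heven_sym"

lemma ev_L_E: "ev_L * ev_E = ev_E * ev_L"
  and ev_L_F: "ev_L * ev_F = ev_F * ev_L"
  and ev_L_H: "ev_L * ev_H = ev_H * ev_L"
  and ev_H_E: "ev_H * ev_E = ev_E * ev_H + 4 *\<^sub>C ev_E"
  and ev_H_F: "ev_H * ev_F = ev_F * ev_H - 4 *\<^sub>C ev_F"
  and ev_E_F: "16 *\<^sub>C (ev_E * ev_F) = (ev_H * ev_H - 2 *\<^sub>C ev_H - 2 *\<^sub>C ev_L)
    * (ev_H * ev_H - 6 *\<^sub>C ev_H - 2 *\<^sub>C ev_L + 8 *\<^sub>C 1)"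
  and ev_F_E: "16 *\<^sub>C (ev_F * ev_E) = (ev_H * ev_H + 2 *\<^sub>C ev_H - 2 *\<^sub>C ev_L)
    * (ev_H * ev_H + 6 *\<^sub>C ev_H - 2 *\<^sub>C ev_L + 8 *\<^sub>C 1)"
proof -
  let ?e = "free_gen E2_sym" and ?f = "free_gen F2_sym" and ?l = "free_gen Lambda_sym"
    and ?h = "free_gen Heven_sym"
  have rel: "abs_presented_algebra r = 0" if "r \<in>
     {lie_bracket ?h ?e - 4 * ?e, lie_bracket ?h ?f - (- 4 * ?f),
      16 * ?e * ?f - (?h^2 - 2 * ?h - 2 * ?l) * (?h^2 - 6 * ?h - 2 * ?l + 8),
      16 * ?f * ?e - (?h^2 + 2 * ?h - 2 * ?l) * (?h^2 + 6 * ?h - 2 * ?l + 8),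
      ?l * ?e - ?e * ?l, ?l * ?f - ?f * ?l, ?l * ?h - ?h * ?l}" for r
    using that by (intro abs_relator) (simp only: relators_even_gen_def Let_def)
  show "ev_L * ev_E = ev_E * ev_L"
    using rel[of "?l * ?e - ?e * ?l"] by (simp add: abs_diff abs_mult abs_free_gen)
  show "ev_L * ev_F = ev_F * ev_L"
    using rel[of "?l * ?f - ?f * ?l"] by (simp add: abs_diff abs_mult abs_free_gen)
  show "ev_L * ev_H = ev_H * ev_L"
    using rel[of "?l * ?h - ?h * ?l"] by (simp add: abs_diff abs_mult abs_free_gen)
  have "abs_presented_algebra (lie_bracket ?h ?e - 4 * ?e) = 0"
    by (rule rel) blast
  then show "ev_H * ev_E = ev_E * ev_H + 4 *\<^sub>C ev_E"
    by (simp add: lie_bracket_def abs_simps algebra_simps)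
  have "abs_presented_algebra (lie_bracket ?h ?f - (- 4 * ?f)) = 0"
    by (rule rel) blast
  then show "ev_H * ev_F = ev_F * ev_H - 4 *\<^sub>C ev_F"
    by (simp add: lie_bracket_def abs_simps algebra_simps)
  have "abs_presented_algebra
      (16 * ?e * ?f - (?h^2 - 2 * ?h - 2 * ?l) * (?h^2 - 6 * ?h - 2 * ?l + 8)) = 0"
    by (rule rel) blast
  then show "16 *\<^sub>C (ev_E * ev_F) = (ev_H * ev_H - 2 *\<^sub>C ev_H - 2 *\<^sub>C ev_L)
      * (ev_H * ev_H - 6 *\<^sub>C ev_H - 2 *\<^sub>C ev_L + 8 *\<^sub>C 1)"
    by (simp add: abs_simps)
  have "abs_presented_algebra
      (16 * ?f * ?e - (?h^2 + 2 * ?h - 2 * ?l) * (?h^2 + 6 * ?h - 2 * ?l + 8)) = 0"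
    by (rule rel) blast
  then show "16 *\<^sub>C (ev_F * ev_E) = (ev_H * ev_H + 2 *\<^sub>C ev_H - 2 *\<^sub>C ev_L)
      * (ev_H * ev_H + 6 *\<^sub>C ev_H - 2 *\<^sub>C ev_L + 8 *\<^sub>C 1)"
    by (simp add: abs_simps)
qed

text \<open>The monomials of degree \<open>2n\<close> share one factor, which is indexed by the integers so that
  multiplication by a generator becomes a shift of the index.\<close>

definition shift_power :: "int \<Rightarrow> even_gen presented_algebra" where
  "shift_power n = (if 0 \<le> n then ev_E ^ nat n else ev_F ^ nat (- n))"

definition normal_monomial :: "int \<times> nat \<times> nat \<Rightarrow> even_gen presented_algebra" where
  "normal_monomial = (\<lambda>(n, i, j). shift_power n * (ev_H ^ i * ev_L ^ j))"

lemma ev_E_shift_power: "0 \<le> n \<Longrightarrow> ev_E * shift_power n = shift_power (n + 1)"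
  by (simp add: shift_power_def nat_add_distrib)

lemma ev_F_shift_power: "n \<le> 0 \<Longrightarrow> ev_F * shift_power n = shift_power (n - 1)"
proof -
  assume "n \<le> 0"
  then have "nat (- (n - 1)) = Suc (nat (- n))" by simp
  with \<open>n \<le> 0\<close> show ?thesis
    by (cases "n = 0") (simp_all add: shift_power_def)
qed

lemma ev_L_shift_power: "ev_L * shift_power n = shift_power n * ev_L"
  using power_commuting_commutes[OF ev_L_E[symmetric]] power_commuting_commutes[OF ev_L_F[symmetric]]
  by (simp add: shift_power_def)

lemma shift_commutator_power:
  fixes h x :: "'g::presentation presented_algebra"
  assumes "h * x = x * h + c *\<^sub>C x"
  shows "h * x ^ n = x ^ n * h + (of_nat n * c) *\<^sub>C x ^ n"
proof (induction n)
  case 0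
  then show ?case by simp
next
  case (Suc n)
  have "h * x ^ Suc n = x * (h * x ^ n) + c *\<^sub>C x ^ Suc n"
    using assms by (simp add: mult.assoc[symmetric] distrib_right scaleC_mult_left)
  also have "\<dots> = x ^ Suc n * h + (of_nat (Suc n) * c) *\<^sub>C x ^ Suc n"
    unfolding Suc.IH
    by (simp add: distrib_left scaleC_mult_right mult.assoc distrib_right
        presented_algebra.scale_left_distrib add_ac)
  finally show ?case .
qed

lemma ev_H_shift_power: "ev_H * shift_power n = shift_power n * ev_H
    + (4 * of_int n) *\<^sub>C shift_power n"
proof (cases "0 \<le> n")
  case True
  then show ?thesis
    using shift_commutator_power[OF ev_H_E, of "nat n"] by (simp add: shift_power_def mult.commute)
next
  case False
  have "ev_H * ev_F = ev_F * ev_H + (- 4) *\<^sub>C ev_F"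
    by (simp add: ev_H_F)
  from shift_commutator_power[OF this, of "nat (- n)"] False show ?thesis
    by (simp add: shift_power_def mult.commute)
qed

definition normal_span :: "even_gen presented_algebra set" where
  "normal_span = presented_algebra.span (range normal_monomial)"

lemma normal_monomial_in_span: "normal_monomial s \<in> normal_span"
  by (simp add: normal_span_def presented_algebra.span_base)

lemma normal_span_closed:
  "x \<in> normal_span \<Longrightarrow> y \<in> normal_span \<Longrightarrow> x + y \<in> normal_span"
  "x \<in> normal_span \<Longrightarrow> y \<in> normal_span \<Longrightarrow> x - y \<in> normal_span"
  "x \<in> normal_span \<Longrightarrow> c *\<^sub>C x \<in> normal_span"
  by (simp_all add: normal_span_def presented_algebra.span_add presented_algebra.span_diff
      presented_algebra.span_scale)

lemma left_mult_normal_span: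
  assumes "\<And>n i j. a * normal_monomial (n, i, j) \<in> normal_span" "x \<in> normal_span"
  shows "a * x \<in> normal_span"
  unfolding normal_span_def
  by (rule left_mult_span) (use assms in \<open>auto simp: normal_span_def\<close>)

lemma ev_L_normal_span: "x \<in> normal_span \<Longrightarrow> ev_L * x \<in> normal_span"
proof (rule left_mult_normal_span)
  fix n i j
  have "ev_L * normal_monomial (n, i, j) = shift_power n * (ev_L * ev_H ^ i * ev_L ^ j)"
    using ev_L_shift_power[of n] by (simp add: normal_monomial_def flip: mult.assoc)
  also have "ev_L * ev_H ^ i = ev_H ^ i * ev_L"
    by (rule power_commuting_commutes[OF ev_L_H[symmetric], symmetric])
  finally have "ev_L * normal_monomial (n, i, j) = normal_monomial (n, i, Suc j)"
    by (simp add: normal_monomial_def mult.assoc)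
  then show "ev_L * normal_monomial (n, i, j) \<in> normal_span"
    by (simp add: normal_monomial_in_span)
qed

lemma ev_H_normal_span: "x \<in> normal_span \<Longrightarrow> ev_H * x \<in> normal_span"
proof (rule left_mult_normal_span)
  fix n i j
  have "ev_H * normal_monomial (n, i, j)
      = normal_monomial (n, Suc i, j) + (4 * of_int n) *\<^sub>C normal_monomial (n, i, j)"
    using arg_cong[OF ev_H_shift_power[of n], of "\<lambda>y. y * (ev_H ^ i * ev_L ^ j)"]
    by (simp add: normal_monomial_def mult.assoc distrib_right scaleC_mult_left)
  then show "ev_H * normal_monomial (n, i, j) \<in> normal_span"
    by (simp add: normal_span_closed normal_monomial_in_span)
qed

text \<open>The products \<open>E\<^sup>2 F\<^sup>2\<close> and \<open>F\<^sup>2 E\<^sup>2\<close> are polynomials in \<open>H\<close> and \<open>\<Lambda>\<close>, under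
  which the span is already known to be stable.\<close>

lemma ev_EF_normal_span:
  assumes x: "x \<in> normal_span"
  shows "ev_E * (ev_F * x) \<in> normal_span" and "ev_F * (ev_E * x) \<in> normal_span"
proof -
  have sixteenth: "y \<in> normal_span" if "16 *\<^sub>C y \<in> normal_span" for y
    using normal_span_closed(3)[OF that, of "1/16"] by simp
  have "16 *\<^sub>C (ev_E * (ev_F * x)) \<in> normal_span"
    using arg_cong[OF ev_E_F, of "\<lambda>y. y * x"]
    by (simp add: mult.assoc scaleC_mult_left distrib_right left_diff_distrib
        normal_span_closed ev_L_normal_span ev_H_normal_span x)
  then show "ev_E * (ev_F * x) \<in> normal_span" by (rule sixteenth)
  have "16 *\<^sub>C (ev_F * (ev_E * x)) \<in> normal_span"
    using arg_cong[OF ev_F_E, of "\<lambda>y. y * x"]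
    by (simp add: mult.assoc scaleC_mult_left distrib_right left_diff_distrib
        normal_span_closed ev_L_normal_span ev_H_normal_span x)
  then show "ev_F * (ev_E * x) \<in> normal_span" by (rule sixteenth)
qed

text \<open>Below degree zero, \<open>E\<^sup>2\<close> meets a factor \<open>F\<^sup>2\<close>, so the preceding lemma applies to the
  monomial that remains. Symmetrically for \<open>F\<^sup>2\<close> above degree zero.\<close>

lemma ev_E_normal_span: "x \<in> normal_span \<Longrightarrow> ev_E * x \<in> normal_span"
proof (rule left_mult_normal_span)
  fix n i j
  show "ev_E * normal_monomial (n, i, j) \<in> normal_span"
  proof (cases "0 \<le> n")
    case True
    then have "ev_E * normal_monomial (n, i, j) = normal_monomial (n + 1, i, j)"
      by (simp add: normal_monomial_def ev_E_shift_power flip: mult.assoc)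
    then show ?thesis by (simp add: normal_monomial_in_span)
  next
    case False
    then have "normal_monomial (n, i, j) = ev_F * normal_monomial (n + 1, i, j)"
      using ev_F_shift_power[of "n + 1"] by (simp add: normal_monomial_def flip: mult.assoc)
    then show ?thesis by (simp add: ev_EF_normal_span normal_monomial_in_span)
  qed
qed

lemma ev_F_normal_span: "x \<in> normal_span \<Longrightarrow> ev_F * x \<in> normal_span"
proof (rule left_mult_normal_span)
  fix n i j
  show "ev_F * normal_monomial (n, i, j) \<in> normal_span"
  proof (cases "n \<le> 0")
    case True
    then have "ev_F * normal_monomial (n, i, j) = normal_monomial (n - 1, i, j)"
      by (simp add: normal_monomial_def ev_F_shift_power flip: mult.assoc)
    then show ?thesis by (simp add: normal_monomial_in_span)
  next
    case False
    then have "normal_monomial (n, i, j) = ev_E * normal_monomial (n - 1, i, j)"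
      using ev_E_shift_power[of "n - 1"] by (simp add: normal_monomial_def flip: mult.assoc)
    then show ?thesis by (simp add: ev_EF_normal_span normal_monomial_in_span)
  qed
qed

lemma normal_monomials_span: "x \<in> presented_algebra.span (range normal_monomial)"
proof -
  have "x \<in> normal_span"
  proof (rule presented_algebra_subspace_UNIV)
    show "presented_algebra.subspace normal_span"
      by (simp add: normal_span_def presented_algebra.subspace_span)
    show "1 \<in> normal_span"
      using normal_monomial_in_span[of "(0, 0, 0)"]
      by (simp add: normal_monomial_def shift_power_def)
    show "gen g * x \<in> normal_span" if "x \<in> normal_span" for g x
      using that
      by (cases g) (simp_all add: ev_E_normal_span ev_F_normal_span ev_L_normal_span ev_H_normal_span)
  qed
  then show ?thesis by (simp add: normal_span_def)
qed

section \<open>A universal weight module\<close>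

text \<open>An element is the family of its coordinates at the weight vectors \<open>v\<^sub>n\<close>. Families of infinite
  support are harmless, and allowing them makes the module a plain function space.\<close>

type_synonym weight_module = "int \<Rightarrow> complex poly poly"

text \<open>The coefficient ring is \<open>\<complex>[h][\<lambda>]\<close>: the inner variable \<open>h\<close> is the weight of \<open>v\<^sub>0\<close>, the outer
  variable \<open>\<lambda>\<close> the value of the Casimir element.\<close>

definition weight_var :: "complex poly poly" where
  "weight_var = [:[:0, 1:]:]"

definition Casimir_var :: "complex poly poly" where
  "Casimir_var = [:0, 1:]"

text \<open>Since \<open>4 F E = 2 \<Lambda> - H\<^sup>2 - 2 H\<close>, the vector \<open>v\<^sub>n\<close> of weight \<open>x = h + 2n\<close> must be an eigenvector
  of \<open>F E\<close> with this eigenvalue. The eigenvalue of \<open>E F\<close> on \<open>v\<^sub>n\<close> is then the one with index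
  \<open>n - 1\<close>.\<close>

definition FE_value :: "int \<Rightarrow> complex poly poly" where
  "FE_value n = (let x = weight_var + 2 * of_int n in smult [:1/4:] (2 * Casimir_var - x\<^sup>2 - 2 * x))"

text \<open>On basis vectors, \<open>E\<close> maps \<open>v\<^sub>n\<close> to a multiple of \<open>v\<^bsub>n+1\<^esub>\<close> and \<open>F\<close> maps \<open>v\<^bsub>n+1\<^esub>\<close> to a multiple of
  \<open>v\<^sub>n\<close>. Only the product of the two coefficients is prescribed. It is given to the operator that
  moves towards \<open>v\<^sub>0\<close>, so that \<open>v\<^sub>0\<close> generates every other \<open>v\<^sub>n\<close> without a coefficient.\<close>

fun weight_op :: "sl2_gen \<Rightarrow> weight_module \<Rightarrow> weight_module" where
  "weight_op E_sym m = (\<lambda>n. (if 1 \<le> n then 1 else FE_value (n - 1)) * m (n - 1))"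
| "weight_op F_sym m = (\<lambda>n. (if n < 0 then 1 else FE_value n) * m (n + 1))"
| "weight_op H_sym m = (\<lambda>n. (weight_var + 2 * of_int n) * m n)"

definition weight_scale :: "complex \<Rightarrow> weight_module \<Rightarrow> weight_module" where
  "weight_scale c m = (\<lambda>n. smult [:c:] (m n))"

lemma weight_scale_numeral: "weight_scale (numeral k) m = (\<lambda>n. numeral k * m n)"
proof -
  have "smult [:numeral k:] y = numeral k * y" for y :: "complex poly poly"
    by (simp add: numeral_poly)
  then show ?thesis by (simp add: weight_scale_def)
qed

interpretation weight: word_action weight_scale weight_op
proof
  fix a b :: complex and x y :: weight_module and g
  show "weight_scale a (x + y) = weight_scale a x + weight_scale a y"
    by (simp add: weight_scale_def fun_eq_iff smult_add_right)
  have "[:a + b:] = [:a:] + [:b:]" by simp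
  then show "weight_scale (a + b) x = weight_scale a x + weight_scale b x"
    by (simp only: weight_scale_def fun_eq_iff smult_add_left plus_fun_apply) simp
  show "weight_scale a (weight_scale b x) = weight_scale (a * b) x"
    by (simp add: weight_scale_def mult.commute)
  show "weight_scale 1 x = x"
    by (simp add: weight_scale_def one_pCons[symmetric])
  show "weight_op g (x + y) = weight_op g x + weight_op g y"
    by (cases g) (simp_all add: fun_eq_iff distrib_left)
  show "weight_op g (weight_scale a x) = weight_scale a (weight_op g x)"
    by (cases g) (simp_all add: weight_scale_def)
qed

lemma four_FE_value: "4 * FE_value n
    = 2 * Casimir_var - (weight_var + 2 * of_int n)\<^sup>2 - 2 * (weight_var + 2 * of_int n)"
  by (simp add: FE_value_def Let_def numeral_poly one_pCons[symmetric])

lemma FE_value_diff: "FE_value (n - 1) - FE_value n = weight_var + 2 * of_int n"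
proof -
  have "4 * (FE_value (n - 1) - FE_value n) = 4 * (weight_var + 2 * of_int n)"
    unfolding right_diff_distrib four_FE_value by (simp add: power2_eq_square algebra_simps)
  then show ?thesis by (simp only: mult_cancel_left) simp
qed

lemma weight_FE: "weight_op F_sym (weight_op E_sym m) = (\<lambda>n. FE_value n * m n)"
  by (auto simp: fun_eq_iff)

lemma weight_EF: "weight_op E_sym (weight_op F_sym m) = (\<lambda>n. FE_value (n - 1) * m n)"
  by (auto simp: fun_eq_iff)

interpretation weight: presented_action weight_scale weight_op
proof
  fix r :: "sl2_gen free_algebra" and m :: weight_module
  assume "r \<in> relators"
  then consider
      "r = lie_bracket (free_gen H_sym) (free_gen E_sym) - 2 * free_gen E_sym"
    | "r = lie_bracket (free_gen H_sym) (free_gen F_sym) - (- 2 * free_gen F_sym)"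
    | "r = lie_bracket (free_gen E_sym) (free_gen F_sym) - free_gen H_sym"
    unfolding relators_sl2_gen_def Let_def by blast
  then show "weight.act r m = 0"
  proof cases
    case 1
    show ?thesis
      unfolding 1
      by (simp add: weight.act_simps lie_bracket_def weight_scale_numeral fun_eq_iff algebra_simps)
  next
    case 2
    show ?thesis
      unfolding 2
      by (simp add: weight.act_simps lie_bracket_def weight_scale_numeral fun_eq_iff algebra_simps)
  next
    case 3
    have "FE_value (n - 1) * m n - FE_value n * m n - (weight_var + 2 * of_int n) * m n = 0" for n
      unfolding left_diff_distrib[symmetric] FE_value_diff by simp
    with 3 show ?thesis
      by (simp add: weight.act_simps lie_bracket_def weight_EF weight_FE fun_eq_iff
          del: weight_op.simps(1,2))
  qed
qed

definition weight_vector :: "int \<Rightarrow> complex poly poly \<Rightarrow> weight_module" where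
  "weight_vector n f = (\<lambda>k. if k = n then f else 0)"

lemma Casimir_weight: "weight.smul Casimir (weight_vector n f) = weight_vector n (Casimir_var * f)"
proof -
  have Casimir_value: "FE_value (k - 1) * y + FE_value k * y
      + smult [:1/2:] ((weight_var + 2 * of_int k)\<^sup>2 * y) = Casimir_var * y" (is "?x = _") for k y
  proof -
    have "4 * ?x = 4 * FE_value (k - 1) * y + 4 * FE_value k * y
        + 2 * (weight_var + 2 * of_int k)\<^sup>2 * y"
      by (simp add: distrib_left numeral_poly)
    also have "\<dots> = 4 * (Casimir_var * y)"
      unfolding four_FE_value by (simp add: power2_eq_square algebra_simps)
    finally show ?thesis by (simp only: mult_cancel_left) simp
  qed
  have "weight.smul Casimir m = (\<lambda>k. Casimir_var * m k)" for m
    by (simp add: Casimir_def weight.smul_add weight.smul_mult weight.smul_gen weight.smul_scaleC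
        weight_EF weight_FE weight_scale_def power2_eq_square fun_eq_iff mult.assoc
        Casimir_value[unfolded power2_eq_square mult.assoc]
        del: weight_op.simps(1,2))
  then show ?thesis
    by (simp add: weight_vector_def fun_eq_iff)
qed

lemma E_weight: "0 \<le> n \<Longrightarrow> weight.smul sl2_E (weight_vector n f) = weight_vector (n + 1) f"
  by (auto simp: weight.smul_gen weight_vector_def fun_eq_iff)

lemma F_weight: "n \<le> 0 \<Longrightarrow> weight.smul sl2_F (weight_vector n f) = weight_vector (n - 1) f"
  by (auto simp: weight.smul_gen weight_vector_def fun_eq_iff)

lemma H_weight: "weight.smul sl2_H (weight_vector 0 f) = weight_vector 0 (weight_var * f)"
  by (auto simp: weight.smul_gen weight_vector_def fun_eq_iff)

lemma smul_power_weight_vector: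
  assumes "\<And>f. weight.smul u (weight_vector n f) = weight_vector n (c * f)"
  shows "weight.smul (u ^ k) (weight_vector n f) = weight_vector n (c ^ k * f)"
  by (induction k) (simp_all add: weight.smul_one weight.smul_mult assms mult.assoc)

lemma E_power_weight:
  "weight.smul ((sl2_E ^ 2) ^ k) (weight_vector 0 f) = weight_vector (2 * int k) f"
  by (induction k)
    (simp_all add: weight.smul_one weight.smul_mult power2_eq_square E_weight algebra_simps)

lemma F_power_weight:
  "weight.smul ((sl2_F ^ 2) ^ k) (weight_vector 0 f) = weight_vector (- 2 * int k) f"
proof (induction k)
  case 0
  then show ?case by (simp add: weight.smul_one)
next
  case (Suc k)
  have "weight.smul ((sl2_F ^ 2) ^ Suc k) (weight_vector 0 f) = weight_vector (- 2 * int k - 1 - 1) f"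
    using Suc.IH by (simp add: weight.smul_mult power2_eq_square F_weight)
  also have "- 2 * int k - 1 - 1 = - 2 * int (Suc k)" by simp
  finally show ?case .
qed

lemma normal_monomial_weight:
  "weight.smul (even_hom (normal_monomial (n, i, j))) (weight_vector 0 1)
    = weight_vector (2 * n) (weight_var ^ i * Casimir_var ^ j)"
proof -
  have "weight.smul (sl2_H ^ i * Casimir ^ j) (weight_vector 0 1)
      = weight_vector 0 (weight_var ^ i * Casimir_var ^ j)"
    by (simp add: weight.smul_mult smul_power_weight_vector Casimir_weight H_weight)
  then show ?thesis
    by (simp add: normal_monomial_def shift_power_def even_hom_mult even_hom_power even_hom_gen
        weight.smul_mult E_power_weight F_power_weight)
qed

section \<open>Injectivity\<close>

text \<open>The coefficient of \<open>h\<^sup>i \<lambda>\<^sup>j v\<^bsub>2n\<^esub>\<close> in \<open>u v\<^sub>0\<close>: as functionals on \<open>U(sl\<^sub>2)\<close> these are dual to the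
  images of the normal monomials.\<close>

definition coordinate :: "int \<times> nat \<times> nat \<Rightarrow> U_sl2 \<Rightarrow> complex" where
  "coordinate = (\<lambda>(n, i, j) u. coeff (coeff (weight.smul u (weight_vector 0 1) (2 * n)) j) i)"

lemma coordinate_zero: "coordinate s 0 = 0"
  by (simp add: coordinate_def weight.smul_zero split: prod.split)

lemma coordinate_add: "coordinate s (u + v) = coordinate s u + coordinate s v"
  by (simp add: coordinate_def weight.smul_add split: prod.split)

lemma coordinate_scaleC: "coordinate s (c *\<^sub>C u) = c * coordinate s u"
  by (simp add: coordinate_def weight.smul_scaleC weight_scale_def split: prod.split)

lemma coeff_weight_monomial:
  "coeff (coeff (weight_var ^ i * Casimir_var ^ j) l) k = (if k = i \<and> l = j then 1 else 0)"
proof -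
  have "Casimir_var ^ j = monom 1 j"
    by (simp add: Casimir_var_def monom_altdef)
  moreover have "weight_var ^ i = [:monom 1 i:]"
    by (simp add: weight_var_def monom_altdef poly_const_pow)
  ultimately have "weight_var ^ i * Casimir_var ^ j = monom (monom 1 i) j"
    by (simp add: smult_monom)
  then show ?thesis by auto
qed

lemma coordinate_normal_monomial:
  "coordinate s (even_hom (normal_monomial t)) = (if s = t then 1 else 0)"
  by (cases s; cases t; simp add: coordinate_def normal_monomial_weight)
    (auto simp: weight_vector_def coeff_weight_monomial)

text \<open>Write an element of the kernel in normal monomials; the dual functionals show that every
  coefficient vanishes.\<close>

lemma even_hom_eq_0:
  assumes "even_hom x = 0" shows "x = 0"
proof -
  obtain T r where T: "finite T" "T \<subseteq> range normal_monomial" and x: "x = (\<Sum>t\<in>T. r t *\<^sub>C t)"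
    using normal_monomials_span[of x] unfolding presented_algebra.span_explicit by blast
  \<comment> \<open>Choosing one index per monomial avoids a separate proof that the monomials are distinct.\<close>
  obtain S where S: "inj_on normal_monomial S" "T = normal_monomial ` S"
    using T(2) by (auto simp: subset_image_inj)
  have fin: "finite S" using T(1) S by (simp add: finite_image_iff)
  have x: "x = (\<Sum>s\<in>S. r (normal_monomial s) *\<^sub>C normal_monomial s)"
    unfolding x S(2) by (simp add: sum.reindex[OF S(1)])
  have coord: "coordinate s (even_hom (\<Sum>t\<in>S. c t *\<^sub>C normal_monomial t))
      = (if s \<in> S then c s else 0)"
    for s c using fin
    by (induction S rule: finite_induct)
      (auto simp: even_hom_zero even_hom_add even_hom_scaleC coordinate_zero coordinate_add
        coordinate_scaleC coordinate_normal_monomial)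
  have "r (normal_monomial s) = 0" if "s \<in> S" for s
    using coord[of s "\<lambda>t. r (normal_monomial t)"] that assms
    unfolding x[symmetric] by (simp add: coordinate_zero)
  then show ?thesis
    unfolding x by simp
qed

lemma inj_even_hom: "inj even_hom"
proof (rule injI)
  fix x y assume "even_hom x = even_hom y"
  then have "even_hom (x - y) = 0"
    using even_hom_add[of "x - y" y] by simp
  then show "x = y"
    using even_hom_eq_0 by fastforce
qed

theorem theorem3p4:
  shows "\<exists>\<phi> :: even_gen presented_algebra \<Rightarrow> U_sl2.
    algebra_hom \<phi>
    \<and> \<phi> (gen E2_sym) = sl2_E ^ 2
    \<and> \<phi> (gen F2_sym) = sl2_F ^ 2
    \<and> \<phi> (gen Lambda_sym) = Casimir
    \<and> \<phi> (gen Heven_sym) = sl2_H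
    \<and> bij_betw \<phi> UNIV U_even"
  by (rule exI[of _ even_hom])
    (simp add: algebra_hom_even_hom even_hom_gen bij_betw_def inj_even_hom range_even_hom)

end
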